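(* Let $a_1,\dots,a_5,\lambda\in\mathbb C\setminus\{0\}$ with $\max_i|a_i|<1$, $|q\lambda|<|a_{12345}|<1$, and $a_j/a_k\notin\{q^m:m\in\mathbb Z\}$ for $j\ne k$ (generic so that all denominators are nonzero). Then $$\int_{-\pi}^{\pi}\frac{(e^{\pm2i\psi},\lambda e^{\pm i\psi};q)_\infty}{(a_1e^{\pm i\psi},\dots,a_5e^{\pm i\psi};q)_\infty}d\psi=\frac{2\pi}{(q;q)_\infty}\mathop{\mathrm{Sym}}_{a_1;a_2,\dots,a_5}\frac{(a_1^{-2},a_1\lambda,\lambda/a_1;q)_\infty}{(a_{12},\dots,a_{15},a_2/a_1,\dots,a_5/a_1;q)_\infty}{}_8W_7\!\left(a_1^2;a_{12},\dots,a_{15},\frac{qa_1}\lambda;q,\frac{q\lambda}{a_{12345}}\right).$$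
   Context: $q\in\mathbb C$, $0<|q|<1$; $(a;q)_\infty=\prod_{j\ge0}(1-aq^j)$, $(a_1,\dots,a_k;q)_\infty$ the product; $e^{\pm i\psi}$ as an entry means both $e^{i\psi},e^{-i\psi}$. $a_{1k}=a_1a_k$, $a_{12345}=a_1\cdots a_5$. $\mathop{\mathrm{Sym}}_{a_1;a_2,\dots,a_n}F$ denotes $F$ plus the $n-1$ expressions obtained by interchanging $a_1$ with $a_k$, $k=2,\dots,n$. ${}_{r+1}W_r(b;a_4,\dots,a_{r+1};q,z)=\sum_{k\ge0}\frac{(q\sqrt b,-q\sqrt b,b,a_4,\dots,a_{r+1};q)_k}{(q,\sqrt b,-\sqrt b,qb/a_4,\dots,qb/a_{r+1};q)_k}z^k$. *)

theory Defs
  imports "HOL-Analysis.Analysis"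
begin

definition qpoch_inf :: "complex \<Rightarrow> complex \<Rightarrow> complex" where
  "qpoch_inf a q = (\<Prod>j. 1 - a * q ^ j)"

definition qpoch :: "complex \<Rightarrow> complex \<Rightarrow> nat \<Rightarrow> complex" where
  "qpoch a q n = (\<Prod>j<n. 1 - a * q ^ j)"

text \<open>Very-well-poised series r+1 W r (b; a_4,...,a_{r+1}; q, z), the parameters
  a_4,...,a_{r+1} given as a list ps (for 8W7 the list has length 5).\<close>
definition vwp_W :: "complex \<Rightarrow> complex list \<Rightarrow> complex \<Rightarrow> complex \<Rightarrow> complex" where
  "vwp_W b ps q z = (\<Sum>k.
     (qpoch (q * csqrt b) q k * qpoch (- q * csqrt b) q k * qpoch b q k
        * (\<Prod>p\<leftarrow>ps. qpoch p q k))
     / (qpoch q q k * qpoch (csqrt b) q k * qpoch (- csqrt b) q k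
        * (\<Prod>p\<leftarrow>ps. qpoch (q * b / p) q k))
     * z ^ k)"

end

theory Submission
  imports Defs "HOL-Complex_Analysis.Complex_Analysis"
begin

text \<open>
  With \<open>z = exp (\<i>\<psi>)\<close> the integral becomes a contour integral of \<open>F z / z\<close> over the unit circle.
  The integrand satisfies \<open>F (q z) = \<rho> z * F z\<close> with a rational function \<open>\<rho>\<close> whose value at 0 is
  \<open>q \<lambda> / a\<^sub>1\<^sub>2\<^sub>3\<^sub>4\<^sub>5\<close>, of modulus less than 1. Hence the integral over the circle of radius
  \<open>r |q| ^ N\<close> tends to 0, and the integral is the sum of the residues at the simple poles
  \<open>a\<^sub>j q\<^sup>k\<close> inside the unit disc. By the same functional equation, consecutive residues have ratio
  \<open>\<rho> (a\<^sub>j q\<^sup>k)\<close>, which is the term ratio of the very-well-poised series.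
\<close>

section \<open>Infinite q-Pochhammer symbols\<close>

lemma convergent_prod_qpoch:
  assumes "norm q < 1"
  shows "convergent_prod (\<lambda>j. 1 - a * q ^ j :: complex)"
  by (intro abs_convergent_prod_imp_convergent_prod summable_imp_abs_convergent_prod)
     (use assms in \<open>simp add: norm_mult norm_power summable_mult summable_geometric\<close>)

lemma qpoch_inf_rec:
  assumes "norm q < 1"
  shows "qpoch_inf a q = (1 - a) * qpoch_inf (a * q) q"
proof (cases "a = 1")
  case True
  have "(\<lambda>j. 1 - a * q ^ j) has_prod (\<Prod>j. 1 - a * q ^ j)"
    by (rule convergent_prod_has_prod[OF convergent_prod_qpoch[OF assms]])
  moreover have "0 \<in> range (\<lambda>j. 1 - a * q ^ j)"
    by (rule range_eqI[of _ _ 0]) (simp add: True)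
  ultimately have "(\<Prod>j. 1 - a * q ^ j) = 0"
    using has_prod_eq_0_iff by blast
  with True show ?thesis by (simp add: qpoch_inf_def)
next
  case False
  \<comment> \<open>Splitting off the head divides by the first factor \<open>1 - a\<close>, so
    \<open>a = 1\<close>, where both sides vanish, is treated apart.\<close>
  then have "(\<Prod>j. 1 - a * q ^ Suc j) = qpoch_inf a q / (1 - a)"
    using prodinf_split_head[OF convergent_prod_qpoch[OF assms, of a]] by (simp add: qpoch_inf_def)
  with False show ?thesis by (simp add: qpoch_inf_def mult.assoc field_simps)
qed

lemma qpoch_inf_split:
  assumes "norm q < 1"
  shows "qpoch_inf a q = (\<Prod>j<n. 1 - a * q ^ j) * qpoch_inf (a * q ^ n) q"
proof (induction n)
  case (Suc n)
  show ?case
    using Suc qpoch_inf_rec[OF assms, of "a * q ^ n"] by (simp add: mult_ac)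
qed auto

lemma qpoch_inf_nonzero:
  assumes "norm q < 1" "\<And>j. a * q ^ j \<noteq> 1"
  shows "qpoch_inf a q \<noteq> 0"
  unfolding qpoch_inf_def
  by (rule prodinf_nonzero[OF convergent_prod_qpoch[OF assms(1)]]) (metis assms(2) eq_iff_diff_eq_0)

lemma qpoch_inf_nonzero_small:
  assumes "norm q < 1" "norm a < 1"
  shows "qpoch_inf a q \<noteq> 0"
proof (rule qpoch_inf_nonzero[OF assms(1)])
  fix j
  have "norm (a * q ^ j) \<le> norm a * 1"
    unfolding norm_mult norm_power by (intro mult_left_mono power_le_one) (use assms in auto)
  then show "a * q ^ j \<noteq> 1" using assms by auto
qed

text \<open>The partial products are polynomials in \<open>a\<close> and converge uniformly on every
  disc \<open>cball z 1\<close>, so the limit is entire.\<close>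

lemma holomorphic_qpoch_inf:
  assumes "norm q < 1"
  shows "(\<lambda>a. qpoch_inf a q) holomorphic_on UNIV"
proof (rule holomorphic_uniform_sequence)
  fix z :: complex
  \<comment> \<open>The factors have the shape \<open>1 + (- x)\<close>, for which uniform
    convergence of the product follows from that of the sum of the \<open>norm x\<close>; a
    geometric series majorizes this sum.\<close>
  define P where "P = (\<lambda>N a. \<Prod>n<N. 1 + (- (a * q ^ n)))"
  have "uniformly_convergent_on (cball z 1) P"
    unfolding P_def
  proof (rule Infinite_Products.uniformly_convergent_on_prod)
    have "uniform_limit (cball z 1) (\<lambda>N x. \<Sum>n<N. norm (- (x * q ^ n)))
            (\<lambda>x. \<Sum>n. norm (- (x * q ^ n))) sequentially"
    proof (rule Weierstrass_m_test)
      show "norm (norm (- (x * q ^ n))) \<le> (norm z + 1) * norm q ^ n" if "x \<in> cball z 1" for n x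
      proof -
        have "norm x \<le> norm z + 1" using that norm_triangle_ineq2[of x z]
          by (auto simp: dist_norm norm_minus_commute)
        then show ?thesis by (simp add: norm_mult norm_power mult_right_mono)
      qed
      show "summable (\<lambda>n. (norm z + 1) * norm q ^ n)"
        using assms by (intro summable_mult summable_geometric) auto
    qed
    then show "uniformly_convergent_on (cball z 1) (\<lambda>N x. \<Sum>n<N. norm (- (x * q ^ n)))"
      by (auto simp: uniformly_convergent_on_def)
  qed (auto intro!: continuous_intros)
  then obtain g where g: "uniform_limit (cball z 1) P g sequentially"
    by (auto simp: uniformly_convergent_on_def)
  have "g x = qpoch_inf x q" if "x \<in> cball z 1" for x
  proof -
    have "(\<lambda>n. P n x) \<longlonglongrightarrow> g x" using tendsto_uniform_limitI[OF g that] .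
    moreover have "(\<lambda>n. P n x) \<longlonglongrightarrow> qpoch_inf x q"
      using convergent_prod_LIMSEQ[OF convergent_prod_qpoch[OF assms, of x]]
      by (simp add: P_def qpoch_inf_def LIMSEQ_lessThan_iff_atMost)
    ultimately show ?thesis using LIMSEQ_unique by blast
  qed
  then have "uniform_limit (cball z 1) P (\<lambda>a. qpoch_inf a q) sequentially"
    using g by (metis (no_types, lifting) uniform_limit_cong')
  then show "\<exists>d>0. cball z d \<subseteq> UNIV \<and>
      uniform_limit (cball z d) (\<lambda>N a. \<Prod>n<N. 1 + (- (a * q ^ n))) (\<lambda>a. qpoch_inf a q) sequentially"
    unfolding P_def by (intro exI[of _ 1]) auto
qed (auto intro!: holomorphic_intros)

lemma holomorphic_on_qpoch_inf [holomorphic_intros]: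
  assumes "norm q < 1" "f holomorphic_on A"
  shows "(\<lambda>z. qpoch_inf (f z) q) holomorphic_on A"
  using holomorphic_on_compose_gen[OF assms(2) holomorphic_qpoch_inf[OF assms(1)]]
  by (simp add: o_def)

lemma tendsto_qpoch_inf [tendsto_intros]:
  assumes "norm q < 1" "(f \<longlongrightarrow> l) F"
  shows "((\<lambda>z. qpoch_inf (f z) q) \<longlongrightarrow> qpoch_inf l q) F"
proof -
  have "continuous_on UNIV (\<lambda>a. qpoch_inf a q)"
    by (rule holomorphic_on_imp_continuous_on[OF holomorphic_qpoch_inf[OF assms(1)]])
  then have "isCont (\<lambda>a. qpoch_inf a q) l"
    by (simp add: continuous_on_eq_continuous_at)
  then show ?thesis using assms(2) by (rule isCont_tendsto_compose)
qed

section \<open>Residues at simple poles in an annulus\<close>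

text \<open>The linear homotopy joins points of equal argument, hence moves radially and never
  leaves the closed annulus.\<close>

lemma contour_integral_circlepath_annulus:
  assumes "open S" "0 < r" "r \<le> R" "\<And>z. r \<le> norm z \<Longrightarrow> norm z \<le> R \<Longrightarrow> z \<in> S"
    and "f holomorphic_on S"
  shows "contour_integral (circlepath 0 R) f = contour_integral (circlepath 0 r) f"
proof (rule Cauchy_theorem_homotopic_loops)
  show "homotopic_loops S (circlepath 0 R) (circlepath 0 r)"
  proof (rule homotopic_loops_linear)
    fix t :: real
    show "closed_segment (circlepath 0 R t) (circlepath 0 r t) \<subseteq> S"
    proof
      fix w assume "w \<in> closed_segment (circlepath 0 R t) (circlepath 0 r t)"
      then obtain u where u: "0 \<le> u" "u \<le> 1"
        "w = (1 - u) *\<^sub>R circlepath 0 R t + u *\<^sub>R circlepath 0 r t"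
        by (auto simp: closed_segment_def)
      have "w = of_real ((1 - u) * R + u * r) * exp (2 * of_real pi * \<i> * of_real t)"
        by (simp add: u(3) circlepath scaleR_conv_of_real algebra_simps)
      then have "norm w = \<bar>(1 - u) * R + u * r\<bar>"
        by (simp only: norm_mult norm_of_real) (simp add: norm_exp_eq_Re)
      moreover have "(1 - u) * R + u * r = r + (1 - u) * (R - r)"
        "(1 - u) * R + u * r = R - u * (R - r)"
        by (simp_all add: algebra_simps)
      moreover have "0 \<le> (1 - u) * (R - r)" "0 \<le> u * (R - r)" using u assms by auto
      ultimately have "r \<le> norm w" "norm w \<le> R" using assms(2,3) by linarith+
      then show "w \<in> S" using assms(4) by blast
    qed
  qed auto
qed (use assms in auto)

text \<open>Induction on the set of poles: after subtraction of the principal part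
  \<open>c p / (z - p)\<close> the singularity at \<open>p\<close> is removable, and the induction
  hypothesis applies to the extended function. The numbers \<open>c p\<close> are the
  residues.\<close>

lemma contour_integral_annulus_simple_poles:
  assumes "finite P" "open S" "0 < r" "r \<le> R"
    "\<And>z. r \<le> norm z \<Longrightarrow> norm z \<le> R \<Longrightarrow> z \<in> S"
    "\<And>p. p \<in> P \<Longrightarrow> r < norm p \<and> norm p < R"
    "f holomorphic_on S - P"
    "\<And>p. p \<in> P \<Longrightarrow> ((\<lambda>z. (z - p) * f z) \<longlongrightarrow> c p) (at p)"
  shows "contour_integral (circlepath 0 R) f - contour_integral (circlepath 0 r) f
           = 2 * of_real pi * \<i> * (\<Sum>p\<in>P. c p)"
  using assms(1,6-8)
proof (induction P arbitrary: f rule: finite_induct)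
  case empty
  then show ?case using contour_integral_circlepath_annulus[of S r R f] assms(2-5) by simp
next
  case (insert p P)
  have pr: "r < norm p" "norm p < R" using insert.prems(1) by auto
  then have pS: "p \<in> S" using assms(5) by simp
  have opn: "open (S - P)" using assms(2) insert.hyps by (simp add: finite_imp_closed open_Diff)
  define g where "g = (\<lambda>z. f z - c p / (z - p))"
  have seteq: "S - insert p P = (S - P) - {p}" by auto
  have gh: "g holomorphic_on (S - P) - {p}"
    unfolding g_def using insert.prems(2) unfolding seteq
    by (intro holomorphic_intros) auto
  \<comment> \<open>This limit is Riemann's criterion for a removable singularity; it provides the
    extension \<open>h\<close>.\<close>
  have "((\<lambda>z. (z - p) * g z) \<longlongrightarrow> 0) (at p)"
  proof -
    have "((\<lambda>z. (z - p) * f z - c p) \<longlongrightarrow> c p - c p) (at p)"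
      by (intro tendsto_intros insert.prems(3)) auto
    moreover have "eventually (\<lambda>z. (z - p) * f z - c p = (z - p) * g z) (at p)"
      unfolding eventually_at_filter by (intro always_eventually) (auto simp: g_def right_diff_distrib)
    ultimately show ?thesis using tendsto_cong by fastforce
  qed
  then obtain h where h: "h holomorphic_on S - P" "\<And>z. z \<in> (S - P) - {p} \<Longrightarrow> h z = g z"
    using holomorphic_on_extend_lim[OF gh] opn pS insert.hyps by (auto simp: interior_open)
  have IH: "contour_integral (circlepath 0 R) h - contour_integral (circlepath 0 r) h
           = 2 * of_real pi * \<i> * (\<Sum>p\<in>P. c p)"
  proof (rule insert.IH)
    show "r < norm p' \<and> norm p' < R" if "p' \<in> P" for p' using insert.prems(1) that by auto
    \<comment> \<open>The subtracted principal part is regular at the other poles \<open>p'\<close>,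
      so it does not change their residues.\<close>
    show "((\<lambda>z. (z - p') * h z) \<longlongrightarrow> c p') (at p')" if p': "p' \<in> P" for p'
    proof -
      have ne: "p' \<noteq> p" using p' insert.hyps by auto
      have "((\<lambda>z. (z - p') * f z - (z - p') * (c p / (z - p))) \<longlongrightarrow>
              c p' - (p' - p') * (c p / (p' - p))) (at p')"
        by (intro tendsto_intros insert.prems(3)) (use p' ne in auto)
      moreover have "eventually (\<lambda>z. (z - p') * f z - (z - p') * (c p / (z - p)) = (z - p') * h z) (at p')"
      proof -
        have "open (S - (insert p P - {p'}))"
          using assms(2) insert.hyps by (simp add: finite_imp_closed open_Diff)
        moreover have "p' \<in> S - (insert p P - {p'})"
          using insert.prems(1)[of p'] p' assms(5)[of p'] by auto
        ultimately have "eventually (\<lambda>z. z \<in> S - (insert p P - {p'}) - {p'}) (at p')"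
          by (auto simp: eventually_at_topological)
        then show ?thesis
          by (rule eventually_mono) (auto simp: h(2) g_def right_diff_distrib)
      qed
      ultimately show ?thesis using tendsto_cong by fastforce
    qed
  qed (rule h(1))
  have circ: "contour_integral (circlepath 0 \<rho>) h =
       contour_integral (circlepath 0 \<rho>) f - c p * contour_integral (circlepath 0 \<rho>) (\<lambda>z. 1 / (z - p))"
    if \<rho>: "\<rho> = r \<or> \<rho> = R" for \<rho>
  proof -
    have "sphere 0 \<rho> \<subseteq> S - insert p P"
      using \<rho> assms(4,5) by (auto dest!: insert.prems(1))
    then have sub: "path_image (circlepath 0 \<rho>) \<subseteq> S - insert p P"
      using \<rho> assms(3,4) by auto
    have pn: "p \<notin> path_image (circlepath 0 \<rho>)" using sub by auto
    have f: "f contour_integrable_on circlepath 0 \<rho>"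
      using sub
      by (intro contour_integrable_holomorphic_simple[OF insert.prems(2)])
         (use assms(2) insert.hyps in \<open>auto simp: finite_imp_closed open_Diff\<close>)
    have i: "(\<lambda>z. 1 / (z - p)) contour_integrable_on circlepath 0 \<rho>"
      by (rule contour_integrable_inversediff) (use pn in auto)
    have "contour_integral (circlepath 0 \<rho>) h = contour_integral (circlepath 0 \<rho>) (\<lambda>z. f z - c p * (1 / (z - p)))"
    proof (rule contour_integral_cong)
      fix z assume "z \<in> path_image (circlepath 0 \<rho>)"
      with sub have "z \<in> S - insert p P" by (rule subsetD)
      then show "h z = f z - c p * (1 / (z - p))" by (simp add: h(2) g_def)
    qed simp
    also have "\<dots> = contour_integral (circlepath 0 \<rho>) f - contour_integral (circlepath 0 \<rho>) (\<lambda>z. c p * (1 / (z - p)))"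
      by (intro contour_integral_diff f contour_integrable_lmul i)
    also have "contour_integral (circlepath 0 \<rho>) (\<lambda>z. c p * (1 / (z - p))) =
       c p * contour_integral (circlepath 0 \<rho>) (\<lambda>z. 1 / (z - p))"
      by (rule contour_integral_lmul[OF i])
    finally show "contour_integral (circlepath 0 \<rho>) h =
       contour_integral (circlepath 0 \<rho>) f - c p * contour_integral (circlepath 0 \<rho>) (\<lambda>z. 1 / (z - p))" .
  qed
  \<comment> \<open>The point \<open>p\<close> lies inside the outer circle and outside the inner
    one, so the principal part contributes exactly once to the difference.\<close>
  have "winding_number (circlepath 0 R) p = 1"
    by (rule winding_number_circlepath) (use pr in auto)
  then have wR: "contour_integral (circlepath 0 R) (\<lambda>z. 1 / (z - p)) = 2 * of_real pi * \<i>"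
    using winding_number_valid_path[of "circlepath 0 R" p] pr assms(3,4)
    by (auto simp: divide_simps)
  have "winding_number (circlepath 0 r) p = 0"
    by (rule winding_number_zero_outside[where s = "cball 0 r"]) (use pr assms(3) in auto)
  then have wr: "contour_integral (circlepath 0 r) (\<lambda>z. 1 / (z - p)) = 0"
    using winding_number_valid_path[of "circlepath 0 r" p] pr assms(3,4)
    by (auto simp: divide_simps)
  show ?case
    using IH circ[of r] circ[of R] wR wr insert.hyps by (simp add: algebra_simps)
qed

section \<open>The functional equation of the integrand\<close>

definition aw_integrand :: "complex \<Rightarrow> complex \<Rightarrow> (nat \<Rightarrow> complex) \<Rightarrow> complex \<Rightarrow> complex" where
  "aw_integrand q lam a z =
     qpoch_inf (z\<^sup>2) q * qpoch_inf (1 / z\<^sup>2) q * qpoch_inf (lam * z) q * qpoch_inf (lam / z) q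
     / (\<Prod>k\<in>{1..5}. qpoch_inf (a k * z) q * qpoch_inf (a k / z) q)"

text \<open>The multiplier in the functional equation of \<open>aw_integrand\<close> under
  \<open>z\<close> to \<open>q * z\<close>. Every factor after the first quotient equals 1 at
  \<open>z = 0\<close>, which makes the value there visible.\<close>

definition aw_ratio :: "complex \<Rightarrow> complex \<Rightarrow> (nat \<Rightarrow> complex) \<Rightarrow> complex \<Rightarrow> complex" where
  "aw_ratio q lam a z =
     q * lam / (\<Prod>k\<in>{1..5}. a k) * ((1 - q\<^sup>2 * z\<^sup>2) / (1 - z\<^sup>2)) * ((1 - q * z / lam) / (1 - lam * z))
     * (\<Prod>k\<in>{1..5}. (1 - a k * z) / (1 - q * z / a k))"

text \<open>Up to the factor \<open>1 / qpoch_inf q q\<close>, the residue of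
  \<open>aw_integrand q lam a z / z\<close> at \<open>a j\<close>.\<close>

definition aw_coeff :: "complex \<Rightarrow> complex \<Rightarrow> (nat \<Rightarrow> complex) \<Rightarrow> nat \<Rightarrow> complex" where
  "aw_coeff q lam a j =
     qpoch_inf (1 / (a j)\<^sup>2) q * qpoch_inf (a j * lam) q * qpoch_inf (lam / a j) q
     / (\<Prod>k\<in>{1..5} - {j}. qpoch_inf (a j * a k) q * qpoch_inf (a k / a j) q)"

text \<open>The summand of \<open>vwp_W\<close> for the index \<open>j\<close>, with the products
  over the parameter list turned into products over the set \<open>{1..5} - {j}\<close> and the
  parameter \<open>q * a j / lam\<close> kept apart.\<close>

definition aw_term :: "complex \<Rightarrow> complex \<Rightarrow> (nat \<Rightarrow> complex) \<Rightarrow> nat \<Rightarrow> nat \<Rightarrow> complex" where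
  "aw_term q lam a j k =
     (qpoch (q * csqrt ((a j)\<^sup>2)) q k * qpoch (- q * csqrt ((a j)\<^sup>2)) q k * qpoch ((a j)\<^sup>2) q k
        * ((\<Prod>i\<in>{1..5} - {j}. qpoch (a j * a i) q k) * qpoch (q * a j / lam) q k))
     / (qpoch q q k * qpoch (csqrt ((a j)\<^sup>2)) q k * qpoch (- csqrt ((a j)\<^sup>2)) q k
        * ((\<Prod>i\<in>{1..5} - {j}. qpoch (q * (a j)\<^sup>2 / (a j * a i)) q k)
            * qpoch (q * (a j)\<^sup>2 / (q * a j / lam)) q k))
     * (q * lam / (\<Prod>i\<in>{1..5}. a i)) ^ k"

text \<open>By \<open>qpoch_inf_rec\<close> each symbol gains or loses one factor, and those in
  \<open>z\<^sup>2\<close> and \<open>1 / z\<^sup>2\<close> two. What remains is common to both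
  sides and is collected in \<open>X\<close>, \<open>Y\<close>, \<open>L\<close>, \<open>M\<close>
  and \<open>Q\<close>.\<close>

lemma aw_integrand_q_shift:
  assumes q: "q \<noteq> 0" "norm q < 1" and nz: "z \<noteq> 0" "lam \<noteq> 0" "\<And>k. k \<in> {1..5} \<Longrightarrow> a k \<noteq> 0"
    and gen: "z\<^sup>2 \<noteq> 1" "q * z\<^sup>2 \<noteq> 1" "lam * z \<noteq> 1"
      "\<And>k. k \<in> {1..5} \<Longrightarrow> a k * z \<noteq> 1" "\<And>k. k \<in> {1..5} \<Longrightarrow> q * z / a k \<noteq> 1"
  shows "aw_integrand q lam a (q * z) = aw_ratio q lam a z * aw_integrand q lam a z"
proof -
  note rec = qpoch_inf_rec[OF q(2)]
  define X Y L M where "X = qpoch_inf (q\<^sup>2 * z\<^sup>2) q" and "Y = qpoch_inf (1 / z\<^sup>2) q"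
    and "L = qpoch_inf (lam * (q * z)) q" and "M = qpoch_inf (lam / z) q"
  define Q where "Q = (\<Prod>k\<in>{1..5}. qpoch_inf (a k * (q * z)) q * qpoch_inf (a k / z) q)"
  define A where "A = (\<Prod>k\<in>{1..5}. a k)"
  define U where "U = (\<Prod>k\<in>{1..5}. 1 - a k * z)"
  define V where "V = (\<Prod>k\<in>{1..5}. 1 - q * z / a k)"
  have nzs: "A \<noteq> 0" "U \<noteq> 0" "V \<noteq> 0" "1 - z\<^sup>2 \<noteq> 0" "1 - q * z\<^sup>2 \<noteq> 0" "1 - lam * z \<noteq> 0"
    using nz gen by (auto simp: A_def U_def V_def)
  have 1: "qpoch_inf (z\<^sup>2) q = (1 - z\<^sup>2) * (1 - q * z\<^sup>2) * X"
    using rec[of "z\<^sup>2"] rec[of "z\<^sup>2 * q"] by (simp add: X_def power2_eq_square mult_ac)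
  have 2: "qpoch_inf (1 / (q * z)\<^sup>2) q = (1 - 1 / (q * z)\<^sup>2) * (1 - 1 / (q * z\<^sup>2)) * Y"
  proof -
    have "1 / (q * z)\<^sup>2 * q = 1 / (q * z\<^sup>2)" "1 / (q * z\<^sup>2) * q = 1 / z\<^sup>2"
      using q(1) by (simp_all add: power2_eq_square)
    then show ?thesis using rec[of "1 / (q * z)\<^sup>2"] rec[of "1 / (q * z\<^sup>2)"] by (simp add: Y_def)
  qed
  have 3: "qpoch_inf (lam * z) q = (1 - lam * z) * L"
    using rec[of "lam * z"] by (simp add: L_def mult_ac)
  have 4: "qpoch_inf (lam / (q * z)) q = (1 - lam / (q * z)) * M"
    using rec[of "lam / (q * z)"] q(1) by (simp add: M_def)
  have 5: "(\<Prod>k\<in>{1..5}. qpoch_inf (a k * z) q * qpoch_inf (a k / z) q) = U * Q"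
  proof -
    have "qpoch_inf (a k * z) q = (1 - a k * z) * qpoch_inf (a k * (q * z)) q" for k
      using rec[of "a k * z"] by (simp add: mult_ac)
    then show ?thesis by (simp add: U_def Q_def prod.distrib mult_ac)
  qed
  have 6: "(\<Prod>k\<in>{1..5}. qpoch_inf (a k * (q * z)) q * qpoch_inf (a k / (q * z)) q)
      = - A / (q * z) ^ 5 * V * Q"
  proof -
    have e: "qpoch_inf (a k / (q * z)) q
        = (- 1 / (q * z)) * a k * (1 - q * z / a k) * qpoch_inf (a k / z) q" if "k \<in> {1..5}" for k
    proof -
      \<comment> \<open>Turning \<open>1 - a k / (q * z)\<close> into \<open>1 - q * z / a k\<close>
        costs \<open>- a k / (q * z)\<close>; over five indices this gives
        \<open>- A / (q * z) ^ 5\<close>.\<close>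
      have "1 - a k / (q * z) = (- 1 / (q * z)) * a k * (1 - q * z / a k)"
        using q(1) nz(1) nz(3)[OF that] by (simp add: field_simps)
      then show ?thesis using rec[of "a k / (q * z)"] q(1) by simp
    qed
    have "(\<Prod>k\<in>{1..5}. qpoch_inf (a k * (q * z)) q * qpoch_inf (a k / (q * z)) q)
        = (\<Prod>k\<in>{1..5}. (- 1 / (q * z)) * a k * (1 - q * z / a k)
             * (qpoch_inf (a k * (q * z)) q * qpoch_inf (a k / z) q))"
      by (rule prod.cong) (auto simp: e)
    also have "\<dots> = (\<Prod>k\<in>{1..5::nat}. - 1 / (q * z)) * A * V * Q"
      by (simp only: prod.distrib A_def V_def Q_def)
    also have "(\<Prod>k\<in>{1..5::nat}. - 1 / (q * z)) = - 1 / (q * z) ^ 5"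
      by (simp add: power_divide)
    finally show ?thesis by simp
  qed
  \<comment> \<open>\<open>Q\<close> vanishes at the poles; there \<open>X * Y * L * M / Q\<close>
    is 0 by the convention for division, and both formulas remain true.\<close>
  have F: "aw_integrand q lam a z = (1 - z\<^sup>2) * (1 - q * z\<^sup>2) * (1 - lam * z) / U * (X * Y * L * M / Q)"
    unfolding aw_integrand_def 1 3 5 by (simp add: Y_def M_def mult_ac)
  have F': "aw_integrand q lam a (q * z) =
      (1 - 1 / (q * z)\<^sup>2) * (1 - 1 / (q * z\<^sup>2)) * (1 - lam / (q * z)) / (- A / (q * z) ^ 5 * V) * (X * Y * L * M / Q)"
    unfolding aw_integrand_def 2 4 6 by (simp add: X_def L_def power_mult_distrib mult_ac)
  have R: "aw_ratio q lam a z = q * lam / A * ((1 - q\<^sup>2 * z\<^sup>2) / (1 - z\<^sup>2)) * ((1 - q * z / lam) / (1 - lam * z)) * (U / V)"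
    by (simp add: aw_ratio_def A_def U_def V_def prod_dividef)
  \<comment> \<open>The numerator yields powers 2, 2 and 1 of \<open>q * z\<close> in the
    denominator. They cancel the fifth power from the five parameters, and only
    \<open>q * lam / A\<close> survives as prefactor.\<close>
  have num: "(1 - 1 / (q * z)\<^sup>2) * (1 - 1 / (q * z\<^sup>2)) * (1 - lam / (q * z))
      = - ((1 - q\<^sup>2 * z\<^sup>2) * (1 - q * z\<^sup>2) * (lam * (1 - q * z / lam)) * q / (q * z) ^ 5)"
  proof -
    have "1 - 1 / (q * z)\<^sup>2 = - (1 - q\<^sup>2 * z\<^sup>2) / (q * z)\<^sup>2"
      using q(1) nz by (simp add: field_simps power_mult_distrib)
    moreover have "1 - 1 / (q * z\<^sup>2) = - (1 - q * z\<^sup>2) * q / (q * z)\<^sup>2"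
      using q(1) nz by (simp add: field_simps power2_eq_square)
    moreover have "1 - lam / (q * z) = - (lam * (1 - q * z / lam)) / (q * z)"
      using q(1) nz by (simp add: field_simps)
    moreover have "(- P / w\<^sup>2) * (- E * q / w\<^sup>2) * (- T / w) = - (P * E * T * q / w ^ 5)" for P E T w :: complex
      by (simp add: eval_nat_numeral mult_ac)
    ultimately show ?thesis by presburger
  qed
  have "(1 - 1 / (q * z)\<^sup>2) * (1 - 1 / (q * z\<^sup>2)) * (1 - lam / (q * z)) / (- A / (q * z) ^ 5 * V)
      = q * lam / A * (1 - q\<^sup>2 * z\<^sup>2) * (1 - q * z\<^sup>2) * (1 - q * z / lam) / V"
  proof -
    have "- (n / w) / (- A / w * V) = n / (A * V)" if "w \<noteq> 0" for n w :: complex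
      using that nzs by (simp add: field_simps)
    from this[of "(q * z) ^ 5"] q(1) nz(1) show ?thesis unfolding num by (simp add: mult_ac)
  qed
  also have "\<dots> = aw_ratio q lam a z * ((1 - z\<^sup>2) * (1 - q * z\<^sup>2) * (1 - lam * z) / U)"
  proof -
    have "c * p * e * r / V = c * (p / y) * (r / w) * (U / V) * (y * e * w / U)"
      if "y \<noteq> 0" "w \<noteq> 0" for c p e r y w :: complex
      using that nzs by (simp add: divide_simps)
    from this[OF nzs(4,6)] show ?thesis unfolding R .
  qed
  finally show ?thesis unfolding F F' by (simp add: mult_ac)
qed

section \<open>Term ratio of the very-well-poised series\<close>

lemma aw_term_0: "aw_term q lam a j 0 = 1"
  by (simp add: aw_term_def qpoch_def)

text \<open>Each finite symbol gains one factor from \<open>k\<close> to \<open>Suc k\<close>;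
  rewritten in \<open>z = a j * q ^ k\<close> these factors form \<open>aw_ratio\<close>.\<close>

lemma aw_term_Suc:
  assumes "q \<noteq> 0" "lam \<noteq> 0" "j \<in> {1..5}" "\<And>k. k \<in> {1..5} \<Longrightarrow> a k \<noteq> 0"
  shows "aw_term q lam a j (Suc k) = aw_ratio q lam a (a j * q ^ k) * aw_term q lam a j k"
proof -
  define s where "s = csqrt ((a j)\<^sup>2)"
  define I where "I = {1..5} - {j}"
  define A where "A = (\<Prod>k\<in>{1..5}. a k)"
  define z where "z = a j * q ^ k"
  have s2: "s * s = (a j)\<^sup>2" unfolding s_def by (metis power2_csqrt power2_eq_square)
  have aj: "a j \<noteq> 0" using assms by auto
  have step: "qpoch x q (Suc k) = qpoch x q k * (1 - x * q ^ k)" for x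
    by (simp add: qpoch_def)
  have "aw_term q lam a j (Suc k) = aw_term q lam a j k *
     ((1 - q * s * q ^ k) * (1 - - q * s * q ^ k) * (1 - (a j)\<^sup>2 * q ^ k)
       * ((\<Prod>i\<in>I. 1 - a j * a i * q ^ k) * (1 - q * a j / lam * q ^ k))
     / ((1 - q * q ^ k) * (1 - s * q ^ k) * (1 - - s * q ^ k)
       * ((\<Prod>i\<in>I. 1 - q * (a j)\<^sup>2 / (a j * a i) * q ^ k) * (1 - q * (a j)\<^sup>2 / (q * a j / lam) * q ^ k)))
     * (q * lam / A))"
    unfolding aw_term_def step prod.distrib A_def I_def s_def
    by (simp only: divide_inverse inverse_mult_distrib power_Suc mult_ac)
  \<comment> \<open>The factors with \<open>s\<close> and \<open>- s\<close> pair up to an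
    expression in \<open>s * s\<close>, so it does not matter whether \<open>csqrt\<close> returns
    \<open>a j\<close> or its negative.\<close>
  also have "(1 - q * s * q ^ k) * (1 - - q * s * q ^ k) = 1 - q\<^sup>2 * z\<^sup>2"
  proof -
    have "(1 - q * s * q ^ k) * (1 - - q * s * q ^ k) = 1 - q * q * q ^ k * q ^ k * (s * s)"
      by (simp add: algebra_simps)
    then show ?thesis unfolding s2 by (simp add: z_def power2_eq_square mult_ac)
  qed
  also have "(1 - q * q ^ k) * (1 - s * q ^ k) * (1 - - s * q ^ k) = (1 - q * z / a j) * (1 - z\<^sup>2)"
  proof -
    have "(1 - s * q ^ k) * (1 - - s * q ^ k) = 1 - q ^ k * q ^ k * (s * s)"
      by (simp add: algebra_simps)
    then show ?thesis unfolding s2 using aj by (simp add: z_def power2_eq_square mult_ac)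
  qed
  also have "(\<Prod>i\<in>I. 1 - q * (a j)\<^sup>2 / (a j * a i) * q ^ k) = (\<Prod>i\<in>I. 1 - q * z / a i)"
    using aj by (simp add: z_def power2_eq_square mult_ac)
  also have "(\<Prod>i\<in>I. 1 - a j * a i * q ^ k) = (\<Prod>i\<in>I. 1 - a i * z)"
    by (simp add: z_def mult_ac)
  also have "1 - (a j)\<^sup>2 * q ^ k = 1 - a j * z"
    by (simp add: z_def power2_eq_square mult_ac)
  also have "1 - q * a j / lam * q ^ k = 1 - q * z / lam"
    by (simp add: z_def)
  also have "1 - q * (a j)\<^sup>2 / (q * a j / lam) * q ^ k = 1 - lam * z"
    using aj assms(1,2) by (simp add: z_def power2_eq_square)
  finally have 1: "aw_term q lam a j (Suc k) = aw_term q lam a j k *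
     ((1 - q\<^sup>2 * z\<^sup>2) * (1 - a j * z) * ((\<Prod>i\<in>I. 1 - a i * z) * (1 - q * z / lam))
     / ((1 - q * z / a j) * (1 - z\<^sup>2) * ((\<Prod>i\<in>I. 1 - q * z / a i) * (1 - lam * z)))
     * (q * lam / A))" .
  \<comment> \<open>The index \<open>j\<close> missing from \<open>I\<close> is supplied by the
    symbols of \<open>(a j)\<^sup>2\<close> in the numerator and of \<open>q\<close> in the
    denominator.\<close>
  have "(\<Prod>k\<in>{1..5}. (1 - a k * z) / (1 - q * z / a k)) =
     (1 - a j * z) / (1 - q * z / a j) * ((\<Prod>i\<in>I. 1 - a i * z) / (\<Prod>i\<in>I. 1 - q * z / a i))"
    using assms(3) by (simp add: I_def prod.remove[of _ j] prod_dividef)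
  then have 2: "aw_ratio q lam a z = q * lam / A * ((1 - q\<^sup>2 * z\<^sup>2) / (1 - z\<^sup>2)) * ((1 - q * z / lam) / (1 - lam * z))
     * ((1 - a j * z) / (1 - q * z / a j) * ((\<Prod>i\<in>I. 1 - a i * z) / (\<Prod>i\<in>I. 1 - q * z / a i)))"
    by (simp add: aw_ratio_def A_def)
  show ?thesis
    unfolding 1 2 z_def[symmetric] by (simp add: mult_ac)
qed

lemma vwp_W_eq_aw_term:
  assumes "j \<in> {1..5}"
  shows "vwp_W ((a j)\<^sup>2) (map (\<lambda>k. a j * a k) (filter (\<lambda>k. k \<noteq> j) [1..<6]) @ [q * a j / lam])
           q (q * lam / (\<Prod>k\<in>{1..5}. a k)) = (\<Sum>k. aw_term q lam a j k)"
proof -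
  have "(\<Prod>p\<leftarrow>map (\<lambda>k. a j * a k) (filter (\<lambda>k. k \<noteq> j) [1..<6]) @ [q * a j / lam]. f p)
        = (\<Prod>i\<in>{1..5} - {j}. f (a j * a i)) * f (q * a j / lam)" for f :: "complex \<Rightarrow> complex"
  proof -
    have "set (filter (\<lambda>k. k \<noteq> j) [1..<6]) = {1..5} - {j}" by auto
    moreover have "distinct (filter (\<lambda>k. k \<noteq> j) [1..<6])" by simp
    ultimately show ?thesis
      using prod.distinct_set_conv_list[of "filter (\<lambda>k. k \<noteq> j) [1..<6]" "\<lambda>i. f (a j * a i)"]
      by (simp add: o_def)
  qed
  then show ?thesis unfolding vwp_W_def aw_term_def by presburger
qed

section \<open>Evaluation of the integral\<close>

lemma mult_less_one_nonneg:
  fixes x y :: real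
  assumes "0 \<le> x" "x < 1" "0 \<le> y" "y < 1"
  shows "x * y < 1"
  using mult_strict_mono'[of x 1 y 1] assms by simp

lemma tendsto_aw_ratio:
  assumes "p\<^sup>2 \<noteq> 1" "lam * p \<noteq> 1" "\<And>k. k \<in> {1..5} \<Longrightarrow> q * p / a k \<noteq> 1"
  shows "(aw_ratio q lam a \<longlongrightarrow> aw_ratio q lam a p) (at p)"
proof -
  have "((\<lambda>z. aw_ratio q lam a z) \<longlongrightarrow> aw_ratio q lam a p) (at p)"
    unfolding aw_ratio_def divide_inverse
    by (intro tendsto_intros) (use assms in \<open>auto simp: divide_inverse\<close>)
  then show ?thesis by simp
qed

lemma holomorphic_aw_integrand:
  assumes "norm q < 1" "0 \<notin> S"
    "\<And>z k. z \<in> S \<Longrightarrow> k \<in> {1..5} \<Longrightarrow> qpoch_inf (a k * z) q \<noteq> 0 \<and> qpoch_inf (a k / z) q \<noteq> 0"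
  shows "aw_integrand q lam a holomorphic_on S"
proof -
  have "(\<lambda>z. aw_integrand q lam a z) holomorphic_on S"
    unfolding aw_integrand_def
    by (intro holomorphic_intros) (use assms in auto)
  then show ?thesis by simp
qed

section \<open>Standing assumptions and the poles inside the unit disc\<close>

text \<open>\<open>generic\<close> separates the five pole sequences \<open>a j * q ^ k\<close>.
  \<open>generic_lam\<close> keeps \<open>1 - lam * z\<close> nonzero on them, that is, the
  denominator parameter \<open>q * (a j)\<^sup>2 / (q * a j / lam) = lam * a j\<close> of the series
  harmless.\<close>

locale askey_wilson_5 =
  fixes q lam :: complex and a :: "nat \<Rightarrow> complex"
  assumes q: "0 < norm q" "norm q < 1"
    and a_nz: "\<And>k. k \<in> {1..5} \<Longrightarrow> a k \<noteq> 0"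
    and lam_nz: "lam \<noteq> 0"
    and a_small: "\<And>k. k \<in> {1..5} \<Longrightarrow> norm (a k) < 1"
    and prod_lower: "norm (q * lam) < norm (\<Prod>k\<in>{1..5}. a k)"
    and prod_upper: "norm (\<Prod>k\<in>{1..5}. a k) < 1"
    and generic: "\<And>j k m. j \<in> {1..5} \<Longrightarrow> k \<in> {1..5} \<Longrightarrow> j \<noteq> k \<Longrightarrow> a j / a k \<noteq> q powi m"
    and generic_lam: "\<And>k m. k \<in> {1..5} \<Longrightarrow> a k * lam * q ^ m \<noteq> 1"
begin

abbreviation "F \<equiv> aw_integrand q lam a"
abbreviation "\<rho> \<equiv> aw_ratio q lam a"

text \<open>The residue of \<open>F z / z\<close> at \<open>a j * q ^ k\<close>, given in closed
  form; \<open>residue_limit\<close> justifies the name.\<close>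

definition res :: "nat \<Rightarrow> nat \<Rightarrow> complex" where
  "res j k = aw_coeff q lam a j / qpoch_inf q q * aw_term q lam a j k"

lemma q_nz: "q \<noteq> 0"
  using q by auto

lemma norm_mult_qpow: "norm (x * q ^ k) \<le> norm x"
proof -
  have "norm x * norm q ^ k \<le> norm x * 1"
    by (intro mult_left_mono power_le_one) (use q in auto)
  then show ?thesis by (simp add: norm_mult norm_power)
qed

lemma generic_pow:
  assumes "j \<in> {1..5}" "k \<in> {1..5}" "j \<noteq> k"
  shows "a j * q ^ m \<noteq> a k * q ^ n"
proof
  assume "a j * q ^ m = a k * q ^ n"
  then have "a j / a k = q ^ n / q ^ m"
    using a_nz assms q_nz by (simp add: divide_simps mult_ac)
  also have "\<dots> = q powi (int n - int m)"
    using q_nz by (simp add: power_int_diff)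
  finally show False using generic[OF assms] by blast
qed

lemma pole_inj:
  assumes "j \<in> {1..5}" "j' \<in> {1..5}" "a j * q ^ k = a j' * q ^ k'"
  shows "j = j' \<and> k = k'"
proof -
  have "j = j'" using generic_pow assms by blast
  moreover have "q ^ k = q ^ k'" using assms a_nz calculation by auto
  then have "norm q ^ k = norm q ^ k'" by (metis norm_power)
  then have "k = k'" using q power_strict_decreasing[of k k' "norm q"] power_strict_decreasing[of k' k "norm q"]
    by (metis less_irrefl linorder_neqE_nat)
  ultimately show ?thesis by blast
qed

text \<open>These are the side conditions of \<open>aw_integrand_q_shift\<close> at a pole. Most
  follow from \<open>norm p < 1\<close>; \<open>q * p / a i = 1\<close> would identify the pole with
  index \<open>Suc k\<close> with the first pole \<open>a i\<close> of some sequence.\<close>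

lemma pole_nonsingular:
  assumes "j \<in> {1..5}"
    and p_def: "p = a j * q ^ k"
  shows "p \<noteq> 0" "norm p < 1" "p\<^sup>2 \<noteq> 1" "q * p\<^sup>2 \<noteq> 1" "lam * p \<noteq> 1"
    "\<And>i. i \<in> {1..5} \<Longrightarrow> a i * p \<noteq> 1" "\<And>i. i \<in> {1..5} \<Longrightarrow> q * p / a i \<noteq> 1"
proof -
  show "p \<noteq> 0" using assms a_nz q_nz by auto
  show n: "norm p < 1" unfolding p_def using norm_mult_qpow a_small assms(1) by (meson le_less_trans)
  have n2: "norm (p\<^sup>2) < 1" using n by (simp add: norm_power power_less_one_iff)
  then show "p\<^sup>2 \<noteq> 1" by auto
  have "norm (q * p\<^sup>2) < 1" using n2 q by (simp add: norm_mult mult_less_one_nonneg)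
  then show "q * p\<^sup>2 \<noteq> 1" by auto
  show "lam * p \<noteq> 1" using generic_lam[OF assms(1), of k] by (simp add: p_def mult_ac)
  show "a i * p \<noteq> 1" if "i \<in> {1..5}" for i
  proof -
    have "norm (a i * p) < 1" using n a_small[OF that] by (simp add: norm_mult mult_less_one_nonneg)
    then show ?thesis by auto
  qed
  show "q * p / a i \<noteq> 1" if i: "i \<in> {1..5}" for i
  proof
    assume "q * p / a i = 1"
    then have "a j * q ^ Suc k = a i * q ^ 0" using a_nz[OF i] by (simp add: p_def mult_ac)
    then show False using pole_inj[OF assms(1) i] by blast
  qed
qed

section \<open>Residues at the poles\<close>

text \<open>Only the first pole of each sequence is computed directly. The map from \<open>z\<close>
  to \<open>q * z\<close> then carries the pole \<open>p\<close> to \<open>q * p\<close>; the factor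
  \<open>q\<close> in \<open>q * z - q * p\<close> cancels against that in \<open>q * z\<close>, so
  the residue is multiplied by \<open>\<rho> p\<close>.\<close>

lemma residue_limit:
  assumes j: "j \<in> {1..5}"
  shows "((\<lambda>z. (z - a j * q ^ k) * (F z / z)) \<longlongrightarrow> res j k) (at (a j * q ^ k))"
proof (induction k)
  case 0
  define I where "I = {1..5} - {j}"
  \<comment> \<open>This is \<open>(z - a j) * (F z / z)\<close> with the vanishing factor
    \<open>1 - a j / z\<close> cancelled, so it is continuous at \<open>a j\<close>.\<close>
  define G where "G = (\<lambda>z. qpoch_inf (z\<^sup>2) q * qpoch_inf (1 / z\<^sup>2) q * qpoch_inf (lam * z) q * qpoch_inf (lam / z) q
     / (qpoch_inf (a j * z) q * qpoch_inf (q * a j / z) q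
         * (\<Prod>i\<in>I. qpoch_inf (a i * z) q * qpoch_inf (a i / z) q)))"
  have aj: "a j \<noteq> 0" "norm (a j) < 1" using a_nz a_small j by auto
  have nz: "qpoch_inf (a j * a i) q \<noteq> 0" if "i \<in> {1..5}" for i
  proof -
    have "norm (a j * a i) < 1" using aj a_small[OF that] by (simp add: norm_mult mult_less_one_nonneg)
    then show ?thesis by (rule qpoch_inf_nonzero_small[OF q(2)])
  qed
  have nzj: "qpoch_inf (a j * a j) q \<noteq> 0" "qpoch_inf q q \<noteq> 0"
    using nz[OF j] qpoch_inf_nonzero_small[OF q(2) q(2)] by auto
  have nz': "qpoch_inf (a i * a j) q * qpoch_inf (a i / a j) q \<noteq> 0" if "i \<in> I" for i
  proof -
    have i: "i \<in> {1..5}" "i \<noteq> j" using that by (auto simp: I_def)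
    have "a i / a j * q ^ m \<noteq> 1" for m
      using generic_pow[OF i(1) j i(2), of m 0] aj by (simp add: field_simps)
    then show ?thesis
      using qpoch_inf_nonzero[OF q(2)] nz[OF i(1)] by (simp add: mult.commute)
  qed
  have "(G \<longlongrightarrow> G (a j)) (at (a j))"
    unfolding G_def
    by (intro tendsto_intros q(2)) (use aj nzj nz' in \<open>auto simp: I_def\<close>)
  moreover have "G (a j) = res j 0"
  proof -
    \<comment> \<open>At \<open>z = a j\<close> the symbols of \<open>z\<^sup>2\<close> and
      \<open>a j * z\<close> coincide and cancel, and \<open>q * a j / z\<close> becomes
      \<open>q\<close>.\<close>
    have "(\<Prod>i\<in>I. qpoch_inf (a i * a j) q * qpoch_inf (a i / a j) q) =
          (\<Prod>i\<in>I. qpoch_inf (a j * a i) q * qpoch_inf (a i / a j) q)"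
      by (simp add: mult.commute)
    then show ?thesis
      unfolding G_def res_def aw_term_0 aw_coeff_def I_def
      using nzj aj by (simp add: power2_eq_square mult_ac)
  qed
  ultimately have "(G \<longlongrightarrow> res j 0) (at (a j))"
    by (rule subst[rotated])
  moreover have "eventually (\<lambda>z. G z = (z - a j) * (F z / z)) (at (a j))"
  proof -
    have "eventually (\<lambda>z. z \<noteq> 0) (at (a j))"
      using aj(1) by (intro tendsto_imp_eventually_ne[OF tendsto_ident_at])
    moreover have "eventually (\<lambda>z. z \<noteq> a j) (at (a j))"
      by (simp add: eventually_at_filter)
    ultimately show ?thesis
    proof eventually_elim
      case (elim z)
      have "qpoch_inf (a j / z) q = (z - a j) / z * qpoch_inf (q * a j / z) q"
        using qpoch_inf_rec[OF q(2), of "a j / z"] elim by (simp add: field_simps)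
      then have "(\<Prod>i\<in>{1..5}. qpoch_inf (a i * z) q * qpoch_inf (a i / z) q) =
         (z - a j) / z * (qpoch_inf (a j * z) q * qpoch_inf (q * a j / z) q
         * (\<Prod>i\<in>I. qpoch_inf (a i * z) q * qpoch_inf (a i / z) q))"
        using j by (simp add: I_def prod.remove[of _ j] mult_ac)
      then show ?case using elim by (simp add: G_def aw_integrand_def)
    qed
  qed
  ultimately have "((\<lambda>z. (z - a j) * (F z / z)) \<longlongrightarrow> res j 0) (at (a j))"
    by (rule Lim_transform_eventually)
  then show ?case by (simp only: power_0 mult_1_right)
next
  case (Suc k)
  define p where "p = a j * q ^ k"
  note ns = pole_nonsingular[OF j p_def]
  have ev: "eventually (\<lambda>z. f z \<noteq> 1) (at p)" if "(f \<longlongrightarrow> f p) (at p)" "f p \<noteq> 1" for f :: "complex \<Rightarrow> complex"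
    using tendsto_imp_eventually_ne[OF that] .
  have "eventually (\<lambda>z. F (q * z) = \<rho> z * F z \<and> z \<noteq> 0) (at p)"
  proof -
    have "eventually (\<lambda>z. \<forall>i\<in>{1..5}. a i * z \<noteq> 1) (at p)"
      "eventually (\<lambda>z. \<forall>i\<in>{1..5}. q * z / a i \<noteq> 1) (at p)"
      by (intro eventually_ball_finite ballI ev tendsto_intros; use ns a_nz in force)+
    moreover have "eventually (\<lambda>z. z \<noteq> 0) (at p)"
      using ns(1) by (intro tendsto_imp_eventually_ne[OF tendsto_ident_at])
    moreover have "eventually (\<lambda>z. z\<^sup>2 \<noteq> 1) (at p)" "eventually (\<lambda>z. q * z\<^sup>2 \<noteq> 1) (at p)"
      "eventually (\<lambda>z. lam * z \<noteq> 1) (at p)"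
      by (intro ev tendsto_intros ns)+
    ultimately show ?thesis
      by eventually_elim (auto intro!: aw_integrand_q_shift simp: q_nz q lam_nz a_nz)
  qed
  then have ev\<rho>: "eventually (\<lambda>z. \<rho> z * ((z - p) * (F z / z)) = (q * z - q * p) * (F (q * z) / (q * z))) (at p)"
  proof eventually_elim
    case (elim z)
    have "q * z - q * p = q * (z - p)" by (simp add: right_diff_distrib)
    with elim show ?case using q_nz by simp
  qed
  have "((\<lambda>z. \<rho> z * ((z - p) * (F z / z))) \<longlongrightarrow> \<rho> p * res j k) (at p)"
    by (intro tendsto_mult tendsto_aw_ratio Suc[folded p_def] ns)
  also have "\<rho> p * res j k = res j (Suc k)"
    unfolding res_def p_def using aw_term_Suc[OF q_nz lam_nz j a_nz] by simp
  finally have 1: "((\<lambda>z. (q * z - q * p) * (F (q * z) / (q * z))) \<longlongrightarrow> res j (Suc k)) (at p)"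
    using ev\<rho> by (rule Lim_transform_eventually)
  \<comment> \<open>Substitution \<open>z = w / q\<close>: the limit at \<open>p\<close> becomes a
    limit at the next pole \<open>q * p\<close>, and punctured neighbourhoods are respected.\<close>
  have "filterlim (\<lambda>w. w / q) (at p) (at (q * p))"
    unfolding filterlim_at
  proof
    have "((\<lambda>w. w / q) \<longlongrightarrow> q * p / q) (at (q * p))"
      by (intro tendsto_intros q_nz)
    then show "((\<lambda>w. w / q) \<longlongrightarrow> p) (at (q * p))" using q_nz by simp
    show "\<forall>\<^sub>F w in at (q * p). w / q \<in> UNIV \<and> w / q \<noteq> p"
      unfolding eventually_at_filter using q_nz by (intro always_eventually) (auto simp: field_simps)
  qed
  from filterlim_compose[OF 1 this] show ?case
    using q_nz by (simp add: p_def mult_ac)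
qed

section \<open>Decay towards the origin\<close>

text \<open>The value of \<open>\<rho>\<close> at 0 has modulus below 1 by
  \<open>prod_lower\<close>, and \<open>\<rho>\<close> is continuous there.\<close>

lemma ratio_bound:
  obtains c \<delta> where "0 < c" "c < 1" "0 < \<delta>" "\<And>z. z \<noteq> 0 \<Longrightarrow> norm z < \<delta> \<Longrightarrow> norm (\<rho> z) \<le> c"
proof -
  define L where "L = norm (q * lam / (\<Prod>k\<in>{1..5}. a k))"
  have "\<rho> 0 = q * lam / (\<Prod>k\<in>{1..5}. a k)" by (simp add: aw_ratio_def)
  then have lim: "((\<lambda>z. norm (\<rho> z)) \<longlongrightarrow> L) (at 0)"
    using tendsto_norm[OF tendsto_aw_ratio[of 0 lam q a]] by (simp add: L_def)
  have "0 < norm (\<Prod>k\<in>{1..5}. a k)"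
    using norm_ge_zero prod_lower by (rule le_less_trans)
  then have "L < 1"
    unfolding L_def norm_divide using prod_lower by (simp only: divide_less_eq_1_pos)
  then obtain c where c: "L < c" "c < 1" using dense by blast
  have "eventually (\<lambda>z. norm (\<rho> z) < c) (at 0)"
    using order_tendstoD(2)[OF lim c(1)] .
  then obtain \<delta> where "0 < \<delta>" "\<And>z. z \<noteq> 0 \<Longrightarrow> dist z 0 < \<delta> \<Longrightarrow> norm (\<rho> z) < c"
    unfolding eventually_at by auto
  moreover have "0 < c" using c(1) by (rule le_less_trans[rotated]) (simp add: L_def)
  ultimately show ?thesis using c(2) by (intro that[of c \<delta>]) (auto simp: less_imp_le)
qed

text \<open>Ratio test: consecutive residues have quotient \<open>\<rho>\<close> at poles that tend
  to 0.\<close>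

lemma summable_res:
  assumes j: "j \<in> {1..5}"
  shows "summable (res j)"
proof -
  obtain c \<delta> where c: "0 < c" "c < 1" "0 < \<delta>" "\<And>z. z \<noteq> 0 \<Longrightarrow> norm z < \<delta> \<Longrightarrow> norm (\<rho> z) \<le> c"
    using ratio_bound by blast
  have "(\<lambda>k. norm (a j) * norm q ^ k) \<longlonglongrightarrow> norm (a j) * 0"
    by (intro tendsto_intros LIMSEQ_power_zero) (use q in auto)
  then have "eventually (\<lambda>k. norm (a j) * norm q ^ k < \<delta>) sequentially"
    using c(3) by (intro order_tendstoD(2)) auto
  then obtain N where N: "\<And>k. N \<le> k \<Longrightarrow> norm (a j * q ^ k) < \<delta>"
    by (auto simp: eventually_sequentially norm_mult norm_power)
  show ?thesis
  proof (rule summable_ratio_test)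
    fix k assume "N \<le> k"
    have "res j (Suc k) = \<rho> (a j * q ^ k) * res j k"
      unfolding res_def using aw_term_Suc[OF q_nz lam_nz j a_nz] by simp
    moreover have "norm (\<rho> (a j * q ^ k)) \<le> c"
      using c(4) N[OF \<open>N \<le> k\<close>] pole_nonsingular(1)[OF j refl] by blast
    ultimately show "norm (res j (Suc k)) \<le> c * norm (res j k)"
      by (simp add: norm_mult mult_right_mono)
  qed (use c in auto)
qed

text \<open>Each step inwards by the factor \<open>q\<close> multiplies \<open>F\<close> by a value
  of \<open>\<rho>\<close>, at the cost of a factor \<open>c\<close>. The bounds on \<open>r\<close>
  keep all points away from the exceptional values of the functional equation.\<close>

lemma norm_integrand_on_circles:
  assumes r: "0 < r" "r < norm q" "\<And>k. k \<in> {1..5} \<Longrightarrow> r < norm (a k)"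
    and c: "0 < c" "\<And>z. z \<noteq> 0 \<Longrightarrow> norm z \<le> r \<Longrightarrow> norm (\<rho> z) \<le> c"
    and B: "\<And>z. norm z = r \<Longrightarrow> norm (F z) \<le> B"
    and z: "norm z = r * norm q ^ N"
  shows "norm (F z) \<le> B * c ^ N"
  using z
proof (induction N arbitrary: z)
  case (Suc N)
  define w where "w = z / q"
  have zw: "z = q * w" using q_nz by (simp add: w_def)
  have nw: "norm w = r * norm q ^ N" using Suc.prems q by (simp add: w_def norm_divide)
  have "r * norm q ^ N \<le> r * 1" by (intro mult_left_mono power_le_one) (use q r in auto)
  then have wr: "norm w \<le> r" using nw by simp
  have w0: "w \<noteq> 0" using nw r(1) q by auto
  have small: "x * w \<noteq> 1" if "norm x * norm w < 1" for x
    using that by (metis norm_mult norm_one less_irrefl)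
  have w1: "norm w < 1" using wr r q by linarith
  have "F (q * w) = \<rho> w * F w"
  proof (rule aw_integrand_q_shift[OF q_nz q(2) w0 lam_nz a_nz])
    show "w\<^sup>2 \<noteq> 1" using small[of w] w1 by (simp add: power2_eq_square mult_less_one_nonneg)
    have "norm (q * w) < 1" using q w1 by (simp add: norm_mult mult_less_one_nonneg)
    then show "q * w\<^sup>2 \<noteq> 1" using small[of "q * w"] w1
      by (simp add: power2_eq_square mult_less_one_nonneg mult.assoc)
    \<comment> \<open>This uses \<open>r < norm q\<close>: \<open>prod_lower\<close> and
      \<open>prod_upper\<close> together give \<open>norm (q * lam) < 1\<close>.\<close>
    have "norm lam * norm w \<le> norm lam * norm q"
      using wr r by (intro mult_left_mono) auto
    also have "\<dots> < 1" using prod_lower prod_upper by (simp add: norm_mult mult.commute)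
    finally show "lam * w \<noteq> 1" by (rule small)
    show "a k * w \<noteq> 1" if "k \<in> {1..5}" for k
      using a_small[OF that] w1 by (intro small) (simp add: mult_less_one_nonneg)
    show "q * w / a k \<noteq> 1" if "k \<in> {1..5}" for k
    proof -
      have "norm (q * w) \<le> 1 * norm w" unfolding norm_mult by (intro mult_right_mono) (use q in auto)
      then have "norm (q * w) < norm (a k)" using wr r(3)[OF that] by simp
      then show ?thesis by (metis less_irrefl a_nz[OF that] divide_eq_1_iff)
    qed
  qed
  then have "norm (F z) = norm (\<rho> w) * norm (F w)" by (simp add: zw norm_mult)
  also have "\<dots> \<le> c * (B * c ^ N)"
    using c(1) c(2)[OF w0 wr] Suc.IH[OF nw] by (intro mult_mono) auto
  finally show ?case by (simp add: mult_ac)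
qed (use B in auto)

section \<open>The residue theorem between the unit circle and a small circle\<close>

text \<open>Shrinking the circle by \<open>norm q ^ N\<close> admits \<open>N\<close> more poles per
  sequence: indices from \<open>N\<close> on are scaled copies of the poles outside radius
  \<open>r\<close>, and smaller ones are covered by \<open>r < norm (a j)\<close>.\<close>

lemma poles_in_annulus:
  assumes r: "0 < r" "\<And>k. k \<in> {1..5} \<Longrightarrow> r < norm (a k)"
    and \<kappa>: "\<And>j k. j \<in> {1..5} \<Longrightarrow> k < \<kappa> j \<Longrightarrow> r < norm (a j * q ^ k)"
    and j: "j \<in> {1..5}" and k: "k < \<kappa> j + N"
  shows "r * norm q ^ N < norm (a j * q ^ k)"
proof (cases "k < N")
  case True
  have "r * norm q ^ N \<le> r * norm q ^ k"
    using True q r(1) by (intro mult_left_mono power_decreasing) auto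
  also have "\<dots> < norm (a j) * norm q ^ k"
    using r(2)[OF j] q by simp
  finally show ?thesis by (simp add: norm_mult norm_power)
next
  case False
  then have "r * norm q ^ N < norm (a j * q ^ (k - N)) * norm q ^ N"
    using \<kappa>[OF j, of "k - N"] k q by simp
  also have "\<dots> = norm (a j * q ^ k)"
    using False by (simp add: norm_mult norm_power mult.assoc flip: power_add)
  finally show ?thesis .
qed

lemma contour_integral_difference:
  assumes r: "0 < r" "r < norm q" "\<And>k. k \<in> {1..5} \<Longrightarrow> r < norm (a k)"
    and \<kappa>: "\<And>j k. j \<in> {1..5} \<Longrightarrow> k < \<kappa> j \<Longrightarrow> r < norm (a j * q ^ k)"
      "\<And>j. j \<in> {1..5} \<Longrightarrow> norm (a j * q ^ \<kappa> j) < r"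
  shows "contour_integral (circlepath 0 1) (\<lambda>z. F z / z)
           - contour_integral (circlepath 0 (r * norm q ^ N)) (\<lambda>z. F z / z)
         = 2 * of_real pi * \<i> * (\<Sum>j\<in>{1..5}. \<Sum>k<\<kappa> j + N. res j k)"
proof -
  define K where "K = (\<lambda>j. \<kappa> j + N)"
  define I where "I = (SIGMA j:{1..5::nat}. {..<K j})"
  define pole where "pole = (\<lambda>(j, k). a j * q ^ k)"
  \<comment> \<open>The annulus lemma wants residues indexed by points, so \<open>pole\<close> is
    inverted; \<open>pole_inj\<close> makes this well defined.\<close>
  define c where "c = (\<lambda>p. case_prod res (inv_into I pole p))"
  \<comment> \<open>The denominator of \<open>F\<close> without the first \<open>K j\<close> factors
    of each symbol of \<open>a j / z\<close>. Those factors carry exactly the poles in the annulus,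
    so \<open>S\<close> is an open set around the closed annulus on which nothing else
    vanishes.\<close>
  define G where "G = (\<lambda>z. \<Prod>j\<in>{1..5}. qpoch_inf (a j * z) q * qpoch_inf (a j * q ^ K j / z) q)"
  define S where "S = - {0} \<inter> G -` (- {0})"
  have inj: "inj_on pole I"
    using pole_inj by (auto simp: inj_on_def I_def pole_def)
  have fin: "finite I" unfolding I_def by auto
  have rq: "0 < r * norm q ^ N" "r * norm q ^ N \<le> 1"
  proof -
    show "0 < r * norm q ^ N" using r q by simp
    have "r * norm q ^ N \<le> 1 * 1" using r q by (intro mult_mono power_le_one) auto
    then show "r * norm q ^ N \<le> 1" by simp
  qed
  have "contour_integral (circlepath 0 1) (\<lambda>z. F z / z)
           - contour_integral (circlepath 0 (r * norm q ^ N)) (\<lambda>z. F z / z)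
         = 2 * of_real pi * \<i> * (\<Sum>p\<in>pole ` I. c p)"
  proof (rule contour_integral_annulus_simple_poles[where S = S])
    have "G holomorphic_on - {0}"
      unfolding G_def by (intro holomorphic_intros q(2)) auto
    then show "open S"
      unfolding S_def by (intro continuous_open_preimage holomorphic_on_imp_continuous_on) auto
    show "z \<in> S" if z: "r * norm q ^ N \<le> norm z" "norm z \<le> 1" for z
    proof -
      have z0: "z \<noteq> 0" using z rq by auto
      have "qpoch_inf (a j * z) q \<noteq> 0 \<and> qpoch_inf (a j * q ^ K j / z) q \<noteq> 0" if j: "j \<in> {1..5}" for j
      proof
        have "norm (a j * z) \<le> norm (a j) * 1" unfolding norm_mult using z by (intro mult_left_mono) auto
        then show "qpoch_inf (a j * z) q \<noteq> 0"
          using a_small[OF j] by (intro qpoch_inf_nonzero_small q(2)) auto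
        have "norm (a j * q ^ K j) = norm (a j * q ^ \<kappa> j) * norm q ^ N"
          by (simp add: K_def norm_mult norm_power power_add)
        also have "\<dots> < r * norm q ^ N" using \<kappa>(2)[OF j] q by simp
        finally have "norm (a j * q ^ K j) < norm z" using z(1) by linarith
        then have "norm (a j * q ^ K j / z) < 1" using z0 by (simp add: norm_divide)
        then show "qpoch_inf (a j * q ^ K j / z) q \<noteq> 0"
          by (rule qpoch_inf_nonzero_small[OF q(2)])
      qed
      then show ?thesis using z0 by (simp add: S_def G_def)
    qed
    show "r * norm q ^ N < norm p \<and> norm p < 1" if "p \<in> pole ` I" for p
    proof -
      obtain j k where jk: "j \<in> {1..5}" "k < \<kappa> j + N" "p = a j * q ^ k"
        using \<open>p \<in> pole ` I\<close> by (auto simp: I_def K_def pole_def)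
      then show ?thesis
        using poles_in_annulus[of r \<kappa> j k N] r \<kappa>(1) pole_nonsingular(2)[OF jk(1,3)] by blast
    qed
    show "(\<lambda>z. F z / z) holomorphic_on S - pole ` I"
    proof (intro holomorphic_on_divide holomorphic_aw_integrand q(2) holomorphic_on_ident)
      fix z k assume z: "z \<in> S - pole ` I" and k: "k \<in> {1..5::nat}"
      have 1: "qpoch_inf (a k * z) q \<noteq> 0" "qpoch_inf (a k * q ^ K k / z) q \<noteq> 0" "z \<noteq> 0"
        using z k by (auto simp: S_def G_def)
      \<comment> \<open>Off the listed poles the factors omitted from \<open>G\<close> are nonzero
        as well.\<close>
      have "1 - a k / z * q ^ i \<noteq> 0" if "i < K k" for i
      proof -
        have "(k, i) \<in> I" using that k by (simp add: I_def)
        then have "z \<noteq> a k * q ^ i" using z by (auto simp: pole_def)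
        then show ?thesis using 1(3) by (simp add: field_simps)
      qed
      then have "qpoch_inf (a k / z) q \<noteq> 0"
        unfolding qpoch_inf_split[OF q(2), of "a k / z" "K k"] using 1 by simp
      with 1 show "qpoch_inf (a k * z) q \<noteq> 0 \<and> qpoch_inf (a k / z) q \<noteq> 0" by blast
    qed (auto simp: S_def)
    show "((\<lambda>z. (z - p) * (F z / z)) \<longlongrightarrow> c p) (at p)" if "p \<in> pole ` I" for p
    proof -
      obtain j k where jk: "j \<in> {1..5}" "(j, k) \<in> I" "p = pole (j, k)"
        using \<open>p \<in> pole ` I\<close> by (auto simp: I_def)
      then have "c p = res j k" by (simp add: c_def inv_into_f_f[OF inj])
      then show ?thesis using residue_limit[OF jk(1), of k] jk(3) by (simp add: pole_def)
    qed
  qed (use fin rq in auto)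
  also have "(\<Sum>p\<in>pole ` I. c p) = (\<Sum>i\<in>I. case_prod res i)"
    unfolding sum.reindex[OF inj] by (rule sum.cong) (auto simp: c_def inv_into_f_f[OF inj])
  also have "\<dots> = (\<Sum>j\<in>{1..5}. \<Sum>k<K j. res j k)"
    unfolding I_def by (subst sum.Sigma) auto
  finally show ?thesis by (simp add: K_def)
qed

section \<open>Shrinking the inner circle to the origin\<close>

lemma contour_integral_eq_residue_sum:
  "contour_integral (circlepath 0 1) (\<lambda>z. F z / z) = 2 * of_real pi * \<i> * (\<Sum>j\<in>{1..5}. \<Sum>k. res j k)"
proof -
  obtain c \<delta> where c: "0 < c" "c < 1" "0 < \<delta>" "\<And>z. z \<noteq> 0 \<Longrightarrow> norm z < \<delta> \<Longrightarrow> norm (\<rho> z) \<le> c"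
    using ratio_bound by blast
  define M where "M = insert \<delta> (insert (norm q) ((\<lambda>k. norm (a k)) ` {1..5}))"
  define m where "m = Min M"
  have M: "finite M" "M \<noteq> {}" "\<And>x. x \<in> M \<Longrightarrow> 0 < x"
    using c(3) q a_nz by (auto simp: M_def)
  then have "0 < m" by (simp add: m_def)
  moreover have "m \<le> x" if "x \<in> M" for x using that M by (simp add: m_def)
  ultimately have m: "0 < m" "m \<le> \<delta>" "m \<le> norm q" "\<And>k. k \<in> {1..5} \<Longrightarrow> m \<le> norm (a k)"
    by (auto simp: M_def)
  \<comment> \<open>Only countably many radii meet a pole, so \<open>r\<close> can be chosen below
    \<open>m\<close> and off all of them.\<close>
  have "countable (\<Union>j\<in>{1..5}. range (\<lambda>k. norm (a j * q ^ k)))"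
    by (intro countable_UN countable_image) auto
  then obtain r where r: "0 < r" "r < m" "r \<notin> (\<Union>j\<in>{1..5}. range (\<lambda>k. norm (a j * q ^ k)))"
    using real_interval_avoid_countable_set[OF m(1)] by (metis greaterThanLessThan_iff)
  have ra: "r < norm (a k)" if "k \<in> {1..5}" for k using r m(4)[OF that] by linarith
  have rq: "r < norm q" using r m by linarith
  have ne: "norm (a j * q ^ k) \<noteq> r" if "j \<in> {1..5}" for j k using r(3) that by blast
  \<comment> \<open>The moduli decrease along each sequence, so \<open>\<kappa> j\<close> counts its
    poles outside radius \<open>r\<close>.\<close>
  define \<kappa> where "\<kappa> = (\<lambda>j. LEAST k. norm (a j * q ^ k) < r)"
  have \<kappa>1: "r < norm (a j * q ^ k)" if "j \<in> {1..5}" "k < \<kappa> j" for j k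
    using not_less_Least[OF that(2)[unfolded \<kappa>_def]] ne[OF that(1)] by (simp add: less_le not_less)
  have \<kappa>2: "norm (a j * q ^ \<kappa> j) < r" if j: "j \<in> {1..5}" for j
  proof -
    obtain k where "norm q ^ k < r"
      using real_arch_pow_inv[OF r(1) q(2)] by blast
    moreover have "norm (a j) * norm q ^ k \<le> 1 * norm q ^ k"
      by (intro mult_right_mono) (use a_small[OF j] in auto)
    ultimately have "norm (a j * q ^ k) < r" by (simp add: norm_mult norm_power)
    then show ?thesis unfolding \<kappa>_def by (rule LeastI)
  qed
  have nonsing: "qpoch_inf (a k * z) q \<noteq> 0 \<and> qpoch_inf (a k / z) q \<noteq> 0"
    if "k \<in> {1..5}" "norm z = r" for k z
  proof
    have "norm (a k * z) < 1"
      unfolding norm_mult using a_small[OF that(1)] that(2) rq q by (intro mult_less_one_nonneg) auto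
    then show "qpoch_inf (a k * z) q \<noteq> 0" by (rule qpoch_inf_nonzero_small[OF q(2)])
    have "a k / z * q ^ j \<noteq> 1" for j
    proof
      assume "a k / z * q ^ j = 1"
      then have "a k * q ^ j = z" by (auto simp: field_simps split: if_splits)
      then show False using ne[OF that(1), of j] that(2) by simp
    qed
    then show "qpoch_inf (a k / z) q \<noteq> 0" by (rule qpoch_inf_nonzero[OF q(2)])
  qed
  have "F holomorphic_on sphere 0 r"
    by (rule holomorphic_aw_integrand) (use q r nonsing in auto)
  then have "compact (F ` sphere 0 r)"
    by (intro compact_continuous_image holomorphic_on_imp_continuous_on) auto
  then obtain B where "\<And>x. x \<in> F ` sphere 0 r \<Longrightarrow> norm x \<le> B"
    using compact_imp_bounded bounded_iff by metis
  then have B: "norm (F z) \<le> B" if "norm z = r" for z using that by auto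
  have "norm (complex_of_real r) = r" using r(1) by simp
  then have B0: "0 \<le> B" using B norm_ge_zero order_trans by blast
  define J where "J = (\<lambda>N. contour_integral (circlepath 0 (r * norm q ^ N)) (\<lambda>z. F z / z))"
  \<comment> \<open>The length of the circle cancels the \<open>1 / z\<close>, so the bound on
    \<open>F\<close> alone gives the decay. If the integrand were not integrable,
    \<open>contour_integral\<close> would be 0 by default and the bound would hold too.\<close>
  have J: "norm (J N) \<le> B * c ^ N * (2 * pi)" for N
  proof (cases "(\<lambda>z. F z / z) contour_integrable_on circlepath 0 (r * norm q ^ N)")
    case True
    have rN: "0 < r * norm q ^ N" using r q by simp
    have "norm (J N) \<le> B * c ^ N / (r * norm q ^ N) * (2 * pi * (r * norm q ^ N))"
    proof (intro has_contour_integral_bound_circlepath)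
      show "((\<lambda>z. F z / z) has_contour_integral J N) (circlepath 0 (r * norm q ^ N))"
        using True by (simp add: J_def has_contour_integral_integral)
      fix z :: complex assume "norm (z - 0) = r * norm q ^ N"
      then have z: "norm z = r * norm q ^ N" by simp
      have "norm (F z) \<le> B * c ^ N"
      proof (rule norm_integrand_on_circles[OF r(1) rq ra c(1)])
        show "norm (\<rho> w) \<le> c" if "w \<noteq> 0" "norm w \<le> r" for w
          using c(4) that r(2) m(2) by simp
      qed (use B z in auto)
      then show "norm (F z / z) \<le> B * c ^ N / (r * norm q ^ N)"
        unfolding norm_divide z using rN by (intro divide_right_mono) auto
    qed (use rN c B0 in auto)
    also have "\<dots> = B * c ^ N * (2 * pi)"
      using q r(1) q_nz by simp
    finally show ?thesis .
  next
    case False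
    then show ?thesis using B0 c by (simp add: J_def not_integrable_contour_integral)
  qed
  have "(\<lambda>N. B * c ^ N * (2 * pi)) \<longlonglongrightarrow> B * 0 * (2 * pi)"
    by (intro tendsto_intros LIMSEQ_power_zero) (use c in auto)
  then have J0: "J \<longlonglongrightarrow> 0"
    by (intro Lim_null_comparison[OF always_eventually[OF allI[OF J]]]) simp
  \<comment> \<open>The sequence is constant, equal to the integral over the unit circle, so its
    limit is that integral.\<close>
  have "(\<lambda>N. J N + 2 * of_real pi * \<i> * (\<Sum>j\<in>{1..5}. \<Sum>k<\<kappa> j + N. res j k))
      \<longlonglongrightarrow> 0 + 2 * of_real pi * \<i> * (\<Sum>j\<in>{1..5}. \<Sum>k. res j k)"
  proof (intro tendsto_add J0 tendsto_mult_left tendsto_sum)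
    fix j :: nat assume "j \<in> {1..5}"
    from LIMSEQ_ignore_initial_segment[OF summable_LIMSEQ[OF summable_res[OF this]], of "\<kappa> j"]
    show "(\<lambda>N. \<Sum>k<\<kappa> j + N. res j k) \<longlonglongrightarrow> (\<Sum>k. res j k)"
      by (simp add: add.commute)
  qed
  moreover have "J N + 2 * of_real pi * \<i> * (\<Sum>j\<in>{1..5}. \<Sum>k<\<kappa> j + N. res j k) =
      contour_integral (circlepath 0 1) (\<lambda>z. F z / z)" for N
    using contour_integral_difference[of r \<kappa> N, OF r(1) rq ra \<kappa>1 \<kappa>2]
    by (simp add: J_def diff_eq_eq add.commute)
  ultimately show ?thesis by (simp add: LIMSEQ_const_iff)
qed

lemma continuous_on_integrand_unit_circle: "continuous_on (sphere 0 1) F"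
proof (intro holomorphic_on_imp_continuous_on holomorphic_aw_integrand q(2))
  fix z :: complex and k :: nat assume "z \<in> sphere 0 1" "k \<in> {1..5}"
  then have "norm (a k * z) < 1" "norm (a k / z) < 1"
    using a_small by (auto simp: norm_mult norm_divide)
  then show "qpoch_inf (a k * z) q \<noteq> 0 \<and> qpoch_inf (a k / z) q \<noteq> 0"
    using qpoch_inf_nonzero_small[OF q(2)] by blast
qed auto

end

section \<open>Return to the real integral\<close>

lemma contour_integral_unit_circle:
  assumes "continuous_on (sphere 0 1) f"
  shows "contour_integral (circlepath 0 1) (\<lambda>z. f z / z) =
           \<i> * integral {-pi..pi} (\<lambda>t. f (exp (\<i> * of_real t)))"
proof -
  define g where "g = (\<lambda>t. f (cis t))"
  have g: "continuous_on A g" for A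
    unfolding g_def by (intro continuous_on_compose2[OF assms] continuous_intros) auto
  then have int: "g integrable_on {x..y}" for x y
    by (intro integrable_continuous_interval)
  have per: "g (t + 2 * pi) = g t" for t by (simp add: g_def flip: cis_mult)
  have "contour_integral (circlepath 0 1) (\<lambda>z. f z / z) = integral {0..2*pi} (\<lambda>t. \<i> * g t)"
    unfolding circlepath_def by (subst contour_integral_part_circlepath_eq) (auto simp: g_def mult_ac)
  also have "\<dots> = \<i> * integral {0..2*pi} g" by simp
  also have "integral {0..2*pi} g = integral {0..pi} g + integral {pi..2*pi} g"
    by (rule Henstock_Kurzweil_Integration.integral_combine[symmetric]) (auto intro: int)
  \<comment> \<open>The circle is parametrized over \<open>{0..2*pi}\<close>; by periodicity its
    second half moves to \<open>{-pi..0}\<close>.\<close>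
  also have "integral {pi..2*pi} g = integral {-pi..0} g"
  proof -
    have "integral {-pi..0} (g \<circ> (\<lambda>t. t + 2 * pi)) = integral {-pi + 2 * pi..0 + 2 * pi} g"
      by (intro integral_shift g)
    then show ?thesis by (simp add: o_def per)
  qed
  also have "integral {0..pi} g + integral {-pi..0} g = integral {-pi..pi} g"
    using Henstock_Kurzweil_Integration.integral_combine[OF _ _ int, of "-pi" 0 pi]
    by (simp add: add.commute)
  finally show ?thesis by (simp add: g_def cis_conv_exp)
qed

theorem theorem2p8:
  fixes q lam :: complex and a :: "nat \<Rightarrow> complex"
  assumes q: "0 < norm q" "norm q < 1"
    and a_nz: "\<forall>k\<in>{1..5}. a k \<noteq> 0"
    and lam_nz: "lam \<noteq> 0"
    and a_small: "\<forall>k\<in>{1..5}. norm (a k) < 1"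
    and prod_lower: "norm (q * lam) < norm (\<Prod>k\<in>{1..5}. a k)"
    and prod_upper: "norm (\<Prod>k\<in>{1..5}. a k) < 1"
    and generic: "\<forall>j\<in>{1..5}. \<forall>k\<in>{1..5}. j \<noteq> k \<longrightarrow> (\<forall>m::int. a j / a k \<noteq> q powi m)"
    and generic_lam: "\<forall>k\<in>{1..5}. \<forall>m::nat. a k * lam * q ^ m \<noteq> 1"
  shows "integral {-pi..pi} (\<lambda>\<psi>::real.
            qpoch_inf (exp (2 * \<i> * of_real \<psi>)) q * qpoch_inf (exp (- 2 * \<i> * of_real \<psi>)) q
            * qpoch_inf (lam * exp (\<i> * of_real \<psi>)) q * qpoch_inf (lam * exp (- \<i> * of_real \<psi>)) q
            / (\<Prod>k\<in>{1..5}. qpoch_inf (a k * exp (\<i> * of_real \<psi>)) q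
                             * qpoch_inf (a k * exp (- \<i> * of_real \<psi>)) q))
       = 2 * of_real pi / qpoch_inf q q *
         (\<Sum>j\<in>{1..5}.
            qpoch_inf (1 / (a j)\<^sup>2) q * qpoch_inf (a j * lam) q * qpoch_inf (lam / a j) q
            / (\<Prod>k\<in>{1..5} - {j}. qpoch_inf (a j * a k) q * qpoch_inf (a k / a j) q)
            * vwp_W ((a j)\<^sup>2)
                (map (\<lambda>k. a j * a k) (filter (\<lambda>k. k \<noteq> j) [1..<6]) @ [q * a j / lam])
                q (q * lam / (\<Prod>k\<in>{1..5}. a k)))"
    (is "integral _ ?f = _ * (\<Sum>j\<in>_. ?g j)")
proof -
  interpret askey_wilson_5 q lam a
    by unfold_locales (use assms in auto)
  have "?f = (\<lambda>\<psi>. F (exp (\<i> * of_real \<psi>)))"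
  proof
    fix \<psi> :: real
    define e where "e = exp (\<i> * of_real \<psi>)"
    have e: "exp (- \<i> * of_real \<psi>) = 1 / e" "exp (2 * \<i> * of_real \<psi>) = e\<^sup>2"
      by (simp_all add: e_def exp_minus inverse_eq_divide mult.assoc flip: exp_double)
    have "exp (- 2 * \<i> * of_real \<psi>) = inverse (exp (2 * \<i> * of_real \<psi>))"
      by (simp flip: exp_minus)
    then have "exp (- 2 * \<i> * of_real \<psi>) = 1 / e\<^sup>2"
      unfolding e by (simp add: inverse_eq_divide)
    with e show "?f \<psi> = F (exp (\<i> * of_real \<psi>))"
      unfolding aw_integrand_def e_def[symmetric] by simp
  qed
  moreover have "?g j = qpoch_inf q q * (\<Sum>k. res j k)" if j: "j \<in> {1..5}" for j
  proof -
    define C where "C = aw_coeff q lam a j"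
    have nz: "qpoch_inf q q \<noteq> 0" by (rule qpoch_inf_nonzero_small[OF q(2) q(2)])
    have "(\<Sum>k. C * aw_term q lam a j k) = C * (\<Sum>k. aw_term q lam a j k)"
    \<comment> \<open>\<open>C\<close> can vanish, for instance when \<open>lam / a j\<close> is a
      non-positive power of \<open>q\<close>. Summability of \<open>res j\<close> then says nothing
      about \<open>aw_term\<close>, but both sides are 0.\<close>
    proof (cases "C = 0")
      case False
      have "summable (\<lambda>k. C / qpoch_inf q q * aw_term q lam a j k)"
        using summable_res[OF j] by (simp add: res_def[abs_def] C_def)
      then have "summable (aw_term q lam a j)"
        using False nz by (subst (asm) summable_cmult_iff) auto
      then show ?thesis by (rule suminf_mult)
    qed simp
    moreover have "(\<Sum>k. C * aw_term q lam a j k) = (\<Sum>k. qpoch_inf q q * res j k)"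
      using nz by (simp add: res_def C_def)
    moreover have "\<dots> = qpoch_inf q q * (\<Sum>k. res j k)"
      by (rule suminf_mult[OF summable_res[OF j]])
    ultimately show ?thesis
      unfolding vwp_W_eq_aw_term[OF j] by (simp add: C_def aw_coeff_def)
  qed
  moreover have "\<i> * integral {-pi..pi} (\<lambda>\<psi>. F (exp (\<i> * of_real \<psi>)))
      = 2 * of_real pi * \<i> * (\<Sum>j\<in>{1..5}. \<Sum>k. res j k)"
    using contour_integral_unit_circle[OF continuous_on_integrand_unit_circle]
      contour_integral_eq_residue_sum by simp
  moreover have "qpoch_inf q q \<noteq> 0" by (rule qpoch_inf_nonzero_small[OF q(2) q(2)])
  ultimately show ?thesis by (simp add: sum_distrib_left[symmetric])
qed

end
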